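(* Let $\mathcal{X}\subseteq\mathbb{R}^d$ be a nonempty closed convex bounded set, $R\ge\max_{x,y\in\mathcal{X}}\|x-y\|$, and let $F\colon\mathcal{X}\to\mathbb{R}^d$ be monotone (with no smoothness assumption), accessed via a stochastic oracle with variance parameter $\sigma^2$; let $G=\max_{x\in\mathcal{X}}\|F(x)\|$. Let $\bar x_T$ be the output of Algorithm AdaPEG (described in the context) with parameters $\gamma_0\ge0$, $\eta>0$. Then \[\mathbb{E}[\mathrm{Err}(\bar x_T)]\le\frac1T\left(\frac12\gamma_0R^2+\left(\sqrt2\frac{R^2}{\eta}+4\sqrt2\eta+R\right)(G+\sigma)\sqrt{T+1}\right)=O\left(\frac{\gamma_0R^2}{T}+\frac{\left(\frac{R^2}{\eta}+\eta+R\right)(G+\sigma)}{\sqrt T}\right).\] In particular, setting $\eta=\Theta(R)$ gives $\mathbb{E}[\mathrm{Err}(\bar x_T)]\le O\left(\frac{\gamma_0R^2}{T}+\frac{R(G+\sigma)}{\sqrt T}\right)$.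
   Context: $\|\cdot\|$ is the Euclidean norm. Monotone: $\langle F(x)-F(y),x-y\rangle\ge0$ for all $x,y$. Stochastic oracle: queried at $x_t$ it returns a random $\widehat{F(x_t)}$ with $\mathbb{E}[\widehat{F(x_t)}\mid x_1,\dots,x_t]=F(x_t)$ and $\mathbb{E}\|\widehat{F(x_t)}-F(x_t)\|^2\le\sigma^2$. $\mathrm{Err}(x)=\sup_{y\in\mathcal{X}}\langle F(y),x-y\rangle$. Algorithm AdaPEG: $x_0=z_0\in\mathcal{X}$. For $t=1,\dots,T$: $x_t=\arg\min_{u\in\mathcal{X}}\{\langle\widehat{F(x_{t-1})},u\rangle+\tfrac12\gamma_{t-1}\|u-z_{t-1}\|^2\}$; $\gamma_t=\frac1\eta\sqrt{\eta^2\gamma_0^2+\sum_{s=1}^t\|\widehat{F(x_s)}-\widehat{F(x_{s-1})}\|^2}$; $z_t=\arg\min_{u\in\mathcal{X}}\{\langle\widehat{F(x_t)},u\rangle+\tfrac12\gamma_{t-1}\|u-z_{t-1}\|^2+\tfrac12(\gamma_t-\gamma_{t-1})\|u-x_t\|^2\}$. Output $\bar x_T=\frac1T\sum_{t=1}^Tx_t$. *)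

theory Defs
  imports "HOL-Analysis.Analysis" "HOL-Probability.Probability"
begin

definition is_filtration :: "'w measure \<Rightarrow> (nat \<Rightarrow> 'w measure) \<Rightarrow> bool" where
  "is_filtration M Fl \<longleftrightarrow>
     (\<forall>t. subalgebra M (Fl t)) \<and> (\<forall>s t. s \<le> t \<longrightarrow> sets (Fl s) \<subseteq> sets (Fl t))"

definition Err :: "('a::real_inner) set \<Rightarrow> ('a \<Rightarrow> 'a) \<Rightarrow> 'a \<Rightarrow> real" where
  "Err X F x = (SUP y\<in>X. inner (F y) (x - y))"

definition adapeg_gamma :: "real \<Rightarrow> real \<Rightarrow> (nat \<Rightarrow> 'a::real_normed_vector) \<Rightarrow> nat \<Rightarrow> real" where
  "adapeg_gamma \<eta> \<gamma>0 gh t =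
     (1 / \<eta>) * sqrt (\<eta>\<^sup>2 * \<gamma>0\<^sup>2 + (\<Sum>s\<in>{1..t}. (norm (gh s - gh (s - 1)))\<^sup>2))"

end

theory Submission
  imports Defs
begin

text \<open>
  Along every sample path AdaPEG is an optimistic proximal method. The optimality conditions of
  its two proximal steps, combined through the three-point identity and summed with the
  AdaGrad-type step sizes, give the regret bound
  \<open>\<Sum>t. \<langle>g t, x t - y\<rangle> \<le> \<gamma>0 R\<^sup>2 / 2 + (R\<^sup>2 / (2 \<eta>) + \<eta>) sqrt S\<^sub>T\<close>, where \<open>S\<^sub>T\<close> is the
  squared variation of the oracle answers. Monotonicity of \<open>F\<close> turns this into a bound on the
  gap of the average iterate, up to the noise terms
  \<open>- (\<Sum>t. \<langle>x t - x0, \<xi> t\<rangle>) + R \<parallel>\<Sum>t. \<xi> t\<parallel>\<close> with \<open>\<xi> t = g t - F (x t)\<close>. In expectation the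
  first vanishes because \<open>x t\<close> is known before \<open>\<xi> t\<close> is drawn and \<open>\<xi> t\<close> has conditional
  mean zero, the second is at most \<open>sqrt T \<sigma>\<close> because the \<open>\<xi> t\<close> are orthogonal martingale
  differences, and \<open>E (sqrt S\<^sub>T) \<le> sqrt (8 T) (G + \<sigma>)\<close> by Jensen's inequality.
\<close>

lemma nonneg_if_nonneg_linear_quadratic:
  fixes L K :: real
  assumes K: "K \<ge> 0" and nonneg: "\<And>s. 0 < s \<Longrightarrow> s \<le> 1 \<Longrightarrow> 0 \<le> s * L + s\<^sup>2 * K"
  shows "0 \<le> L"
proof (rule ccontr)
  assume "\<not> 0 \<le> L"
  define s where "s = min 1 (- L / (2 * K + 1))"
  have s: "0 < s" "s \<le> 1"
    using \<open>\<not> 0 \<le> L\<close> K by (auto simp: s_def divide_neg_pos add_nonneg_pos)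
  have "s * K \<le> - L / (2 * K + 1) * K" using K by (intro mult_right_mono) (auto simp: s_def)
  also have "\<dots> < - L"
    using \<open>\<not> 0 \<le> L\<close> K mult_nonneg_nonpos[of K L] by (simp add: field_simps)
  finally have "s * (L + s * K) < 0" using s by (simp add: mult_pos_neg)
  with nonneg[OF s] show False by (simp add: power2_eq_square algebra_simps)
qed

lemma norm_add_scaleR_sq:
  "(norm (v + s *\<^sub>R d))\<^sup>2 = (norm v)\<^sup>2 + 2 * s * inner v d + s\<^sup>2 * (norm (d::'a::real_inner))\<^sup>2"
  unfolding power2_norm_eq_inner
  by (simp add: inner_add_left inner_add_right inner_commute power2_eq_square algebra_simps)

lemma prox_arg_min_variational_ineq:
  fixes X :: "'a::real_inner set"
  assumes "convex X"
    and arg_min: "is_arg_min (\<lambda>u. inner a u + 1/2 * \<alpha> * (norm (u - p))\<^sup>2 + 1/2 * \<beta> * (norm (u - q))\<^sup>2)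
                    (\<lambda>u. u \<in> X) w"
    and "\<alpha> \<ge> 0" "\<beta> \<ge> 0" "y \<in> X"
  shows "0 \<le> inner a (y - w) + \<alpha> * inner (w - p) (y - w) + \<beta> * inner (w - q) (y - w)"
    (is "0 \<le> ?L")
proof (rule nonneg_if_nonneg_linear_quadratic)
  define f where "f u = inner a u + 1/2 * \<alpha> * (norm (u - p))\<^sup>2 + 1/2 * \<beta> * (norm (u - q))\<^sup>2" for u
  define d where "d = y - w"
  have "w \<in> X" and min: "\<And>v. v \<in> X \<Longrightarrow> f w \<le> f v"
    using arg_min unfolding is_arg_min_def f_def by (auto simp: not_less)
  show "0 \<le> (\<alpha> + \<beta>) / 2 * (norm d)\<^sup>2" using assms by simp
  fix s :: real assume "0 < s" "s \<le> 1"
  have "w + s *\<^sub>R d = (1 - s) *\<^sub>R w + s *\<^sub>R y" by (simp add: d_def algebra_simps)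
  also have "\<dots> \<in> X" using convexD[OF \<open>convex X\<close> \<open>w \<in> X\<close> \<open>y \<in> X\<close>] \<open>0 < s\<close> \<open>s \<le> 1\<close> by simp
  finally have le: "f w \<le> f (w + s *\<^sub>R d)" by (rule min)
  have sq: "(norm (w + s *\<^sub>R d - c))\<^sup>2
      = (norm (w - c))\<^sup>2 + 2 * s * inner (w - c) d + s\<^sup>2 * (norm d)\<^sup>2" for c
    using norm_add_scaleR_sq[of "w - c" s d] by (simp add: algebra_simps)
  have "f (w + s *\<^sub>R d) = f w + (s * ?L + s\<^sup>2 * ((\<alpha> + \<beta>) / 2 * (norm d)\<^sup>2))"
    unfolding f_def d_def[symmetric] sq by (simp add: inner_add_right algebra_simps)
  with le show "0 \<le> s * ?L + s\<^sup>2 * ((\<alpha> + \<beta>) / 2 * (norm d)\<^sup>2)" by simp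
qed

lemma inner_three_point:
  "inner (u - v) (w - u) = ((norm (w - v))\<^sup>2 - (norm (u - v))\<^sup>2 - (norm (w - u))\<^sup>2) / 2"
  using dot_norm[of "u - v" "w - u"] by simp

text \<open>For \<open>q = 0\<close> the right-hand side is \<open>0\<close> (division by zero), whence the side condition.\<close>
lemma inner_sub_half_norm_sq_le:
  fixes D d :: "'a::real_inner"
  assumes "q \<ge> 0" and "q = 0 \<Longrightarrow> D = 0"
  shows "inner D d - q / 2 * (norm d)\<^sup>2 \<le> (norm D)\<^sup>2 / (2 * q)"
proof (cases "q = 0")
  case False
  with assms have "q > 0" by simp
  have "0 \<le> (norm (D - q *\<^sub>R d))\<^sup>2" by simp
  also have "\<dots> = (norm D)\<^sup>2 - 2 * q * inner D d + q\<^sup>2 * (norm d)\<^sup>2"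
    using norm_add_scaleR_sq[of D "- q" d] by simp
  finally show ?thesis using \<open>q > 0\<close> by (simp add: field_simps power2_eq_square)
qed (use assms in simp)

text \<open>The three-point identity turns both variational inequalities into
  differences of squared distances; the error \<open>g' - g\<close> is absorbed by Young's inequality.\<close>
lemma optimistic_step_ineq:
  fixes x' z z' y g g' :: "'a::real_inner"
  assumes vi_x: "0 \<le> inner g (z' - x') + p * inner (x' - z) (z' - x')"
    and vi_z: "0 \<le> inner g' (y - z') + p * inner (z' - z) (y - z') + (q - p) * inner (z' - x') (y - z')"
    and "0 \<le> p" "p \<le> q" "norm (y - x') \<le> R" and "q = 0 \<Longrightarrow> g' = g"
  shows "inner g' (x' - y) \<le> p / 2 * (norm (y - z))\<^sup>2 - q / 2 * (norm (y - z'))\<^sup>2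
           + (q - p) / 2 * R\<^sup>2 + (norm (g' - g))\<^sup>2 / (2 * q)"
proof -
  have three_point:
    "p * inner (z' - z) (y - z') = p/2 * (norm (y - z))\<^sup>2 - p/2 * (norm (z' - z))\<^sup>2 - p/2 * (norm (y - z'))\<^sup>2"
    "(q - p) * inner (z' - x') (y - z')
       = (q - p)/2 * (norm (y - x'))\<^sup>2 - (q - p)/2 * (norm (z' - x'))\<^sup>2 - (q - p)/2 * (norm (y - z'))\<^sup>2"
    "p * inner (x' - z) (z' - x') = p/2 * (norm (z' - z))\<^sup>2 - p/2 * (norm (x' - z))\<^sup>2 - p/2 * (norm (z' - x'))\<^sup>2"
    by (simp_all only: inner_three_point) (simp_all add: field_simps)
  have split: "inner g' (x' - y) = - inner g' (y - z') - inner g (z' - x') + inner (g - g') (z' - x')"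
    by (simp add: inner_diff_left inner_diff_right)
  have young: "inner (g - g') (z' - x') - q/2 * (norm (z' - x'))\<^sup>2 \<le> (norm (g' - g))\<^sup>2 / (2 * q)"
    using inner_sub_half_norm_sq_le[of q "g - g'" "z' - x'"] assms by (simp add: norm_minus_commute)
  have diam: "(q - p)/2 * (norm (y - x'))\<^sup>2 \<le> (q - p)/2 * R\<^sup>2"
    using assms by (intro mult_left_mono power_mono) auto
  have merge: "p/2 * N + (q - p)/2 * N = q/2 * N" for N :: real
    by (simp add: field_simps)
  have "0 \<le> p/2 * (norm (x' - z))\<^sup>2" using \<open>0 \<le> p\<close> by simp
  then show ?thesis
    using vi_x vi_z three_point split young diam merge[of "(norm (y - z'))\<^sup>2"] merge[of "(norm (z' - x'))\<^sup>2"]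
    by linarith
qed

definition sq_variation :: "(nat \<Rightarrow> 'a::real_normed_vector) \<Rightarrow> nat \<Rightarrow> real" where
  "sq_variation g t = (\<Sum>s\<in>{1..t}. (norm (g s - g (s - 1)))\<^sup>2)"

lemma sq_variation_0 [simp]: "sq_variation g 0 = 0"
  by (simp add: sq_variation_def)

lemma sq_variation_Suc: "sq_variation g (Suc t) = sq_variation g t + (norm (g (Suc t) - g t))\<^sup>2"
  by (simp add: sq_variation_def)

lemma sq_variation_nonneg: "0 \<le> sq_variation g t"
  by (simp add: sq_variation_def sum_nonneg)

lemma sq_variation_mono: "s \<le> t \<Longrightarrow> sq_variation g s \<le> sq_variation g t"
  unfolding sq_variation_def by (rule sum_mono2) auto

lemma adapeg_gamma_sq_variation:
  "adapeg_gamma \<eta> \<gamma>0 g t = sqrt (\<eta>\<^sup>2 * \<gamma>0\<^sup>2 + sq_variation g t) / \<eta>"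
  by (simp add: adapeg_gamma_def sq_variation_def)

lemma adapeg_gamma_nonneg: "0 < \<eta> \<Longrightarrow> 0 \<le> adapeg_gamma \<eta> \<gamma>0 g t"
  by (simp add: adapeg_gamma_sq_variation sq_variation_nonneg)

lemma adapeg_gamma_mono:
  "0 < \<eta> \<Longrightarrow> s \<le> t \<Longrightarrow> adapeg_gamma \<eta> \<gamma>0 g s \<le> adapeg_gamma \<eta> \<gamma>0 g t"
  unfolding adapeg_gamma_sq_variation using sq_variation_mono[of s t g]
  by (intro divide_right_mono) auto

lemma adapeg_gamma_Suc_eq_0D:
  assumes "0 < \<eta>" and "adapeg_gamma \<eta> \<gamma>0 g (Suc t) = 0"
  shows "g (Suc t) = g t"
proof -
  have "\<eta>\<^sup>2 * \<gamma>0\<^sup>2 + sq_variation g (Suc t) = 0"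
    using assms by (simp add: adapeg_gamma_sq_variation)
  then have "(norm (g (Suc t) - g t))\<^sup>2 \<le> 0"
    using sq_variation_nonneg[of g t] by (simp add: sq_variation_Suc add_nonneg_eq_0_iff)
  then show ?thesis by simp
qed

lemma adapeg_gamma_le:
  assumes "0 < \<eta>" "0 \<le> \<gamma>0"
  shows "adapeg_gamma \<eta> \<gamma>0 g t \<le> \<gamma>0 + sqrt (sq_variation g t) / \<eta>"
proof -
  have "sqrt (\<eta>\<^sup>2 * \<gamma>0\<^sup>2 + sq_variation g t) \<le> sqrt (\<eta>\<^sup>2 * \<gamma>0\<^sup>2) + sqrt (sq_variation g t)"
    by (rule sqrt_add_le_add_sqrt) (auto simp: sq_variation_nonneg)
  also have "sqrt (\<eta>\<^sup>2 * \<gamma>0\<^sup>2) = \<eta> * \<gamma>0" using assms by (simp add: real_sqrt_mult)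
  finally show ?thesis using assms by (simp add: adapeg_gamma_sq_variation field_simps)
qed

lemma diff_div_sqrt_add_le:
  fixes c S S' :: real
  assumes "0 \<le> c" "0 \<le> S" "S \<le> S'"
  shows "(S' - S) / sqrt (c + S') \<le> 2 * (sqrt S' - sqrt S)"
proof (cases "S' = 0")
  case False
  with assms have "0 < S'" by simp
  have "(S' - S) / sqrt (c + S') \<le> (S' - S) / sqrt S'"
    using assms \<open>0 < S'\<close> by (intro divide_left_mono) auto
  also have "\<dots> = (sqrt S' - sqrt S) * (sqrt S' + sqrt S) / sqrt S'"
    using assms by (simp add: algebra_simps)
  also have "\<dots> \<le> (sqrt S' - sqrt S) * (2 * sqrt S') / sqrt S'"
    using assms by (intro divide_right_mono mult_left_mono) auto
  also have "\<dots> = 2 * (sqrt S' - sqrt S)" using \<open>0 < S'\<close> by simp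
  finally show ?thesis .
qed (use assms in simp)

lemma sum_sq_increment_div_adapeg_gamma_le:
  assumes "0 < \<eta>" "0 \<le> \<gamma>0"
  shows "(\<Sum>t\<in>{1..T}. (norm (g t - g (t - 1)))\<^sup>2 / (2 * adapeg_gamma \<eta> \<gamma>0 g t))
           \<le> \<eta> * sqrt (sq_variation g T)"
proof (induction T)
  case (Suc T)
  have "(norm (g (Suc T) - g T))\<^sup>2 / (2 * adapeg_gamma \<eta> \<gamma>0 g (Suc T))
        = \<eta> / 2 * ((sq_variation g (Suc T) - sq_variation g T)
                     / sqrt (\<eta>\<^sup>2 * \<gamma>0\<^sup>2 + sq_variation g (Suc T)))"
    using assms by (simp add: adapeg_gamma_sq_variation sq_variation_Suc field_simps)
  also have "\<dots> \<le> \<eta> / 2 * (2 * (sqrt (sq_variation g (Suc T)) - sqrt (sq_variation g T)))"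
    using assms
    by (intro mult_left_mono diff_div_sqrt_add_le) (auto simp: sq_variation_nonneg sq_variation_mono)
  finally show ?case using Suc by (simp add: algebra_simps)
qed simp

text \<open>The AdaPEG updates with the index shifted: round \<open>t + 1\<close> computes \<open>x (Suc t)\<close> and
  \<open>z (Suc t)\<close>, using the answer \<open>g t\<close> of the oracle queried at \<open>x t\<close>.\<close>
definition adapeg_iterates ::
    "'a::real_inner set \<Rightarrow> real \<Rightarrow> real \<Rightarrow> (nat \<Rightarrow> 'a) \<Rightarrow> (nat \<Rightarrow> 'a) \<Rightarrow> (nat \<Rightarrow> 'a) \<Rightarrow> bool" where
  "adapeg_iterates X \<eta> \<gamma>0 g x z \<longleftrightarrow> (\<forall>t.
     is_arg_min (\<lambda>u. inner (g t) u + 1/2 * adapeg_gamma \<eta> \<gamma>0 g t * (norm (u - z t))\<^sup>2)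
       (\<lambda>u. u \<in> X) (x (Suc t)) \<and>
     is_arg_min (\<lambda>u. inner (g (Suc t)) u + 1/2 * adapeg_gamma \<eta> \<gamma>0 g t * (norm (u - z t))\<^sup>2
                    + 1/2 * (adapeg_gamma \<eta> \<gamma>0 g (Suc t) - adapeg_gamma \<eta> \<gamma>0 g t)
                          * (norm (u - x (Suc t)))\<^sup>2)
       (\<lambda>u. u \<in> X) (z (Suc t)))"

lemma adapeg_iterates_in:
  assumes "adapeg_iterates X \<eta> \<gamma>0 g x z"
  shows "x (Suc t) \<in> X" "z (Suc t) \<in> X"
  using assms by (auto simp: adapeg_iterates_def is_arg_min_def)

lemma adapeg_step_le:
  fixes X :: "'a::real_inner set"
  assumes "convex X" and diam: "\<forall>u\<in>X. \<forall>v\<in>X. norm (u - v) \<le> R" and "0 < \<eta>"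
    and iter: "adapeg_iterates X \<eta> \<gamma>0 g x z" and "y \<in> X"
  defines "\<Gamma> \<equiv> adapeg_gamma \<eta> \<gamma>0 g"
  shows "inner (g (Suc t)) (x (Suc t) - y)
           \<le> \<Gamma> t / 2 * (norm (y - z t))\<^sup>2 - \<Gamma> (Suc t) / 2 * (norm (y - z (Suc t)))\<^sup>2
             + (\<Gamma> (Suc t) - \<Gamma> t) / 2 * R\<^sup>2 + (norm (g (Suc t) - g t))\<^sup>2 / (2 * \<Gamma> (Suc t))"
proof (rule optimistic_step_ineq)
  have arg_min_x: "is_arg_min (\<lambda>u. inner (g t) u + 1/2 * \<Gamma> t * (norm (u - z t))\<^sup>2
                     + 1/2 * 0 * (norm (u - z t))\<^sup>2) (\<lambda>u. u \<in> X) (x (Suc t))"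
    using iter by (simp add: adapeg_iterates_def \<Gamma>_def)
  have arg_min_z: "is_arg_min (\<lambda>u. inner (g (Suc t)) u + 1/2 * \<Gamma> t * (norm (u - z t))\<^sup>2
                     + 1/2 * (\<Gamma> (Suc t) - \<Gamma> t) * (norm (u - x (Suc t)))\<^sup>2) (\<lambda>u. u \<in> X) (z (Suc t))"
    using iter by (simp add: adapeg_iterates_def \<Gamma>_def)
  show "0 \<le> \<Gamma> t" "\<Gamma> t \<le> \<Gamma> (Suc t)"
    using \<open>0 < \<eta>\<close> by (simp_all add: \<Gamma>_def adapeg_gamma_nonneg adapeg_gamma_mono)
  then show "0 \<le> inner (g t) (z (Suc t) - x (Suc t)) + \<Gamma> t * inner (x (Suc t) - z t) (z (Suc t) - x (Suc t))"
    using prox_arg_min_variational_ineq[OF \<open>convex X\<close> arg_min_x] adapeg_iterates_in[OF iter] by simp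
  show "0 \<le> inner (g (Suc t)) (y - z (Suc t)) + \<Gamma> t * inner (z (Suc t) - z t) (y - z (Suc t))
          + (\<Gamma> (Suc t) - \<Gamma> t) * inner (z (Suc t) - x (Suc t)) (y - z (Suc t))"
    using prox_arg_min_variational_ineq[OF \<open>convex X\<close> arg_min_z] \<open>y \<in> X\<close> \<open>\<Gamma> t \<le> \<Gamma> (Suc t)\<close> \<open>0 \<le> \<Gamma> t\<close>
    by simp
  show "norm (y - x (Suc t)) \<le> R" using diam \<open>y \<in> X\<close> adapeg_iterates_in[OF iter] by blast
  show "\<Gamma> (Suc t) = 0 \<Longrightarrow> g (Suc t) = g t"
    using adapeg_gamma_Suc_eq_0D[OF \<open>0 < \<eta>\<close>] by (simp add: \<Gamma>_def)
qed

lemma adapeg_regret_le: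
  fixes X :: "'a::real_inner set"
  assumes "convex X" "z 0 \<in> X" and diam: "\<forall>u\<in>X. \<forall>v\<in>X. norm (u - v) \<le> R"
    and "0 < \<eta>" "0 \<le> \<gamma>0" and iter: "adapeg_iterates X \<eta> \<gamma>0 g x z" and "y \<in> X"
  shows "(\<Sum>t\<in>{1..T}. inner (g t) (x t - y)) \<le> \<gamma>0 / 2 * R\<^sup>2 + (R\<^sup>2 / (2 * \<eta>) + \<eta>) * sqrt (sq_variation g T)"
proof -
  define \<Gamma> where "\<Gamma> = adapeg_gamma \<eta> \<gamma>0 g"
  have telescoped: "(\<Sum>t\<in>{1..T}. inner (g t) (x t - y))
      \<le> \<Gamma> 0 / 2 * (norm (y - z 0))\<^sup>2 - \<Gamma> T / 2 * (norm (y - z T))\<^sup>2 + (\<Gamma> T - \<Gamma> 0) / 2 * R\<^sup>2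
        + (\<Sum>t\<in>{1..T}. (norm (g t - g (t - 1)))\<^sup>2 / (2 * \<Gamma> t))" for T
  proof (induction T)
    case (Suc T)
    have "(\<Gamma> (Suc T) - \<Gamma> 0) / 2 * R\<^sup>2 = (\<Gamma> T - \<Gamma> 0) / 2 * R\<^sup>2 + (\<Gamma> (Suc T) - \<Gamma> T) / 2 * R\<^sup>2"
      by (simp add: field_simps)
    with Suc.IH adapeg_step_le[OF assms(1,3,4) iter \<open>y \<in> X\<close>, of T, folded \<Gamma>_def] show ?case
      by (simp only: sum.cl_ivl_Suc) simp
  qed simp
  have "\<Gamma> 0 / 2 * (norm (y - z 0))\<^sup>2 \<le> \<Gamma> 0 / 2 * R\<^sup>2"
    using assms by (intro mult_left_mono power_mono) (auto simp: \<Gamma>_def adapeg_gamma_nonneg)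
  moreover have "0 \<le> \<Gamma> T / 2 * (norm (y - z T))\<^sup>2"
    using \<open>0 < \<eta>\<close> by (simp add: \<Gamma>_def adapeg_gamma_nonneg)
  moreover have "\<Gamma> T / 2 * R\<^sup>2 \<le> (\<gamma>0 + sqrt (sq_variation g T) / \<eta>) / 2 * R\<^sup>2"
    using adapeg_gamma_le[OF \<open>0 < \<eta>\<close> \<open>0 \<le> \<gamma>0\<close>] by (intro mult_right_mono divide_right_mono) (auto simp: \<Gamma>_def)
  moreover have "(\<gamma>0 + sqrt (sq_variation g T) / \<eta>) / 2 * R\<^sup>2 + \<eta> * sqrt (sq_variation g T)
      = \<gamma>0 / 2 * R\<^sup>2 + (R\<^sup>2 / (2 * \<eta>) + \<eta>) * sqrt (sq_variation g T)"
    using \<open>0 < \<eta>\<close> by (simp add: field_simps)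
  moreover have "\<Gamma> 0 / 2 * R\<^sup>2 + (\<Gamma> T - \<Gamma> 0) / 2 * R\<^sup>2 = \<Gamma> T / 2 * R\<^sup>2"
    by (simp add: field_simps)
  ultimately show ?thesis
    using telescoped[of T] sum_sq_increment_div_adapeg_gamma_le[OF \<open>0 < \<eta>\<close> \<open>0 \<le> \<gamma>0\<close>, of g T]
    unfolding \<Gamma>_def by linarith
qed

lemma Err_le:
  assumes "X \<noteq> {}" and "\<And>y. y \<in> X \<Longrightarrow> inner (F y) (x - y) \<le> c"
  shows "Err X F x \<le> c"
  unfolding Err_def using assms by (intro cSUP_least) auto

lemma Err_nonneg:
  assumes "x \<in> X" and "\<And>y. y \<in> X \<Longrightarrow> inner (F y) (x - y) \<le> c"
  shows "0 \<le> Err X F x"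
proof -
  have "inner (F x) (x - x) \<le> Err X F x"
    unfolding Err_def using assms by (intro cSUP_upper) (auto simp: bdd_above_def)
  then show ?thesis by simp
qed

lemma monotone_inner_average_le:
  fixes F :: "'a::real_inner \<Rightarrow> 'a"
  assumes mono: "\<forall>u\<in>X. \<forall>v\<in>X. inner (F u - F v) (u - v) \<ge> 0"
    and "\<And>t. t \<in> {1..T} \<Longrightarrow> x t \<in> X" and "y \<in> X" and "1 \<le> T"
  shows "inner (F y) ((1 / real T) *\<^sub>R (\<Sum>t\<in>{1..T}. x t) - y)
           \<le> (\<Sum>t\<in>{1..T}. inner (F (x t)) (x t - y)) / real T"
proof -
  have "(1 / real T) *\<^sub>R (\<Sum>t\<in>{1..T}. x t) - y = (1 / real T) *\<^sub>R (\<Sum>t\<in>{1..T}. x t - y)"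
    using \<open>1 \<le> T\<close> by (simp add: sum_subtractf scaleR_diff_right sum_constant_scaleR)
  then have "inner (F y) ((1 / real T) *\<^sub>R (\<Sum>t\<in>{1..T}. x t) - y)
      = (\<Sum>t\<in>{1..T}. inner (F y) (x t - y)) / real T"
    by (simp add: inner_sum_right)
  also have "\<dots> \<le> (\<Sum>t\<in>{1..T}. inner (F (x t)) (x t - y)) / real T"
    using mono assms(2,3) by (intro divide_right_mono sum_mono) (force simp: inner_diff_left)+
  finally show ?thesis .
qed

text \<open>\<open>\<xi> t\<close> stands for the oracle error \<open>g t - F (x t)\<close>.\<close>
definition adapeg_gap_bound ::
    "real \<Rightarrow> real \<Rightarrow> real \<Rightarrow> (nat \<Rightarrow> 'a::real_inner) \<Rightarrow> (nat \<Rightarrow> 'a) \<Rightarrow> (nat \<Rightarrow> 'a) \<Rightarrow> 'a \<Rightarrow> nat \<Rightarrow> real"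
  where
  "adapeg_gap_bound \<eta> \<gamma>0 R g \<xi> x p T =
     \<gamma>0 / 2 * R\<^sup>2 + (R\<^sup>2 / (2 * \<eta>) + \<eta>) * sqrt (sq_variation g T)
     - (\<Sum>t\<in>{1..T}. inner (x t - p) (\<xi> t)) + R * norm (\<Sum>t\<in>{1..T}. \<xi> t)"

lemma adapeg_Err_average_le:
  fixes X :: "'a::real_inner set" and F :: "'a \<Rightarrow> 'a"
  assumes "convex X" "z 0 \<in> X" "p \<in> X"
    and diam: "\<forall>u\<in>X. \<forall>v\<in>X. norm (u - v) \<le> R"
    and mono: "\<forall>u\<in>X. \<forall>v\<in>X. inner (F u - F v) (u - v) \<ge> 0"
    and "0 < \<eta>" "0 \<le> \<gamma>0" "1 \<le> T" and iter: "adapeg_iterates X \<eta> \<gamma>0 g x z"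
  defines "B \<equiv> adapeg_gap_bound \<eta> \<gamma>0 R g (\<lambda>t. g t - F (x t)) x p T"
  shows "Err X F ((1 / real T) *\<^sub>R (\<Sum>t\<in>{1..T}. x t)) \<le> B / real T"
    and "0 \<le> Err X F ((1 / real T) *\<^sub>R (\<Sum>t\<in>{1..T}. x t))"
proof -
  have x_in: "x t \<in> X" if "t \<in> {1..T}" for t
    using adapeg_iterates_in(1)[OF iter, of "t - 1"] that by simp
  have gap: "inner (F y) ((1 / real T) *\<^sub>R (\<Sum>t\<in>{1..T}. x t) - y) \<le> B / real T" if "y \<in> X" for y
  proof -
    have "(\<Sum>t\<in>{1..T}. inner (F (x t)) (x t - y))
        = (\<Sum>t\<in>{1..T}. inner (g t) (x t - y) - inner (x t - p) (g t - F (x t))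
                         + inner (g t - F (x t)) (y - p))"
      by (rule sum.cong) (simp_all add: inner_diff_left inner_diff_right inner_commute)
    also have "\<dots> = (\<Sum>t\<in>{1..T}. inner (g t) (x t - y)) - (\<Sum>t\<in>{1..T}. inner (x t - p) (g t - F (x t)))
          + inner (\<Sum>t\<in>{1..T}. g t - F (x t)) (y - p)"
      by (simp add: sum.distrib sum_subtractf inner_sum_left inner_diff_left)
    also have "\<dots> \<le> B"
    proof -
      have "inner (\<Sum>t\<in>{1..T}. g t - F (x t)) (y - p) \<le> norm (\<Sum>t\<in>{1..T}. g t - F (x t)) * norm (y - p)"
        by (rule norm_cauchy_schwarz)
      also have "\<dots> \<le> R * norm (\<Sum>t\<in>{1..T}. g t - F (x t))"
        using diam \<open>y \<in> X\<close> \<open>p \<in> X\<close> by (simp add: mult.commute mult_right_mono)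
      finally show ?thesis
        using adapeg_regret_le[OF assms(1,2) diam assms(6,7) iter \<open>y \<in> X\<close>, of T]
        unfolding B_def adapeg_gap_bound_def by linarith
    qed
    finally have "(\<Sum>t\<in>{1..T}. inner (F (x t)) (x t - y)) / real T \<le> B / real T"
      by (simp add: divide_right_mono)
    with monotone_inner_average_le[where x = x, OF mono x_in \<open>y \<in> X\<close> \<open>1 \<le> T\<close>] show ?thesis
      by linarith
  qed
  have "(\<Sum>t\<in>{1..T}. (1 / real T) *\<^sub>R x t) \<in> X"
    using \<open>1 \<le> T\<close> by (intro convex_sum[OF _ \<open>convex X\<close>]) (auto simp: x_in)
  then have "(1 / real T) *\<^sub>R (\<Sum>t\<in>{1..T}. x t) \<in> X"
    by (simp add: scaleR_sum_right)
  then show "0 \<le> Err X F ((1 / real T) *\<^sub>R (\<Sum>t\<in>{1..T}. x t))"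
    using gap by (rule Err_nonneg)
  from gap show "Err X F ((1 / real T) *\<^sub>R (\<Sum>t\<in>{1..T}. x t)) \<le> B / real T"
    using \<open>p \<in> X\<close> by (intro Err_le) auto
qed

lemma (in prob_space) integral_sqrt_le_sqrt_integral:
  fixes f :: "'a \<Rightarrow> real"
  assumes f: "integrable M f" and nonneg: "\<And>\<omega>. \<omega> \<in> space M \<Longrightarrow> 0 \<le> f \<omega>"
  shows "integrable M (\<lambda>\<omega>. sqrt (f \<omega>))" and "(\<integral>\<omega>. sqrt (f \<omega>) \<partial>M) \<le> sqrt (\<integral>\<omega>. f \<omega> \<partial>M)"
proof -
  have [measurable]: "f \<in> borel_measurable M" using f by auto
  show sqrt_f: "integrable M (\<lambda>\<omega>. sqrt (f \<omega>))"
  proof (rule Bochner_Integration.integrable_bound[of _ "\<lambda>\<omega>. 1 + f \<omega>"])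
    show "AE \<omega> in M. norm (sqrt (f \<omega>)) \<le> norm (1 + f \<omega>)"
    proof (rule AE_I2)
      fix \<omega> assume "\<omega> \<in> space M"
      then have "f \<omega> \<le> (1 + f \<omega>)\<^sup>2" using nonneg by (simp add: power2_eq_square algebra_simps)
      then show "norm (sqrt (f \<omega>)) \<le> norm (1 + f \<omega>)"
        using nonneg[OF \<open>\<omega> \<in> space M\<close>] real_sqrt_le_mono by fastforce
    qed
  qed (use f in auto)
  have "integrable M (\<lambda>\<omega>. (sqrt (f \<omega>))\<^sup>2) \<longleftrightarrow> integrable M f"
    by (rule Bochner_Integration.integrable_cong) (simp_all add: nonneg)
  moreover have "(\<integral>\<omega>. (sqrt (f \<omega>))\<^sup>2 \<partial>M) = (\<integral>\<omega>. f \<omega> \<partial>M)"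
    by (rule Bochner_Integration.integral_cong) (simp_all add: nonneg)
  ultimately have "0 \<le> (\<integral>\<omega>. f \<omega> \<partial>M) - (\<integral>\<omega>. sqrt (f \<omega>) \<partial>M)\<^sup>2"
    using variance_positive[of "\<lambda>\<omega>. sqrt (f \<omega>)"] variance_eq[OF sqrt_f] f by simp
  then show "(\<integral>\<omega>. sqrt (f \<omega>) \<partial>M) \<le> sqrt (\<integral>\<omega>. f \<omega> \<partial>M)"
    by (intro real_le_rsqrt) simp
qed

lemma (in prob_space) integral_mult_eq_0_if_cond_mean_zero:
  fixes f u :: "'a \<Rightarrow> real"
  assumes N: "subalgebra M N" and u: "integrable M u"
    and mean_zero: "\<And>A. A \<in> sets N \<Longrightarrow> (\<integral>\<omega>\<in>A. u \<omega> \<partial>M) = 0"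
    and f: "f \<in> borel_measurable N" and fu: "integrable M (\<lambda>\<omega>. f \<omega> * u \<omega>)"
  shows "(\<integral>\<omega>. f \<omega> * u \<omega> \<partial>M) = 0"
proof -
  interpret finite_measure_subalgebra M N by unfold_locales (rule N)
  have "AE \<omega> in M. real_cond_exp M N u \<omega> = 0"
    using real_cond_exp_charact[of u "\<lambda>_. 0"] mean_zero u by auto
  then have "(\<integral>\<omega>. f \<omega> * real_cond_exp M N u \<omega> \<partial>M) = 0"
    by (intro integral_eq_zero_AE) auto
  then show ?thesis
    using real_cond_exp_intg(2)[OF fu f] u by auto
qed

lemma (in prob_space) integral_inner_eq_0_if_cond_mean_zero:
  fixes h e :: "'a \<Rightarrow> 'b::euclidean_space"
  assumes N: "subalgebra M N" and e: "integrable M e"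
    and mean_zero: "\<And>A. A \<in> sets N \<Longrightarrow> (LINT \<omega>:A|M. e \<omega>) = 0"
    and h: "h \<in> borel_measurable N"
    and h2: "integrable M (\<lambda>\<omega>. (norm (h \<omega>))\<^sup>2)" and e2: "integrable M (\<lambda>\<omega>. (norm (e \<omega>))\<^sup>2)"
  shows "integrable M (\<lambda>\<omega>. inner (h \<omega>) (e \<omega>))" and "(\<integral>\<omega>. inner (h \<omega>) (e \<omega>) \<partial>M) = 0"
proof -
  have [measurable]: "h \<in> borel_measurable M" by (rule measurable_from_subalg[OF N h])
  have [measurable]: "e \<in> borel_measurable M" using e by auto
  have product_integrable: "integrable M (\<lambda>\<omega>. inner (h \<omega>) b * inner (e \<omega>) b)" if "b \<in> Basis" for b
  proof (rule Bochner_Integration.integrable_bound[of _ "\<lambda>\<omega>. (norm (h \<omega>))\<^sup>2 + (norm (e \<omega>))\<^sup>2"])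
    have "\<bar>inner (h \<omega>) b * inner (e \<omega>) b\<bar> \<le> (norm (h \<omega>))\<^sup>2 + (norm (e \<omega>))\<^sup>2" for \<omega>
    proof -
      have "(inner (h \<omega>) b)\<^sup>2 \<le> (norm (h \<omega>))\<^sup>2" "(inner (e \<omega>) b)\<^sup>2 \<le> (norm (e \<omega>))\<^sup>2"
        using Basis_le_norm[OF that] by (simp_all add: abs_le_square_iff[symmetric])
      moreover have "2 * \<bar>inner (h \<omega>) b\<bar> * \<bar>inner (e \<omega>) b\<bar> \<le> (inner (h \<omega>) b)\<^sup>2 + (inner (e \<omega>) b)\<^sup>2"
        using sum_squares_bound[of "\<bar>inner (h \<omega>) b\<bar>" "\<bar>inner (e \<omega>) b\<bar>"] by simp
      moreover have "0 \<le> \<bar>inner (h \<omega>) b\<bar> * \<bar>inner (e \<omega>) b\<bar>" by simp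
      ultimately show ?thesis unfolding abs_mult by linarith
    qed
    then show "AE \<omega> in M. norm (inner (h \<omega>) b * inner (e \<omega>) b) \<le> norm ((norm (h \<omega>))\<^sup>2 + (norm (e \<omega>))\<^sup>2)"
      by simp
  qed (use h2 e2 in auto)
  have "(\<integral>\<omega>. inner (h \<omega>) b * inner (e \<omega>) b \<partial>M) = 0" if "b \<in> Basis" for b
  proof (rule integral_mult_eq_0_if_cond_mean_zero[OF N])
    fix A assume "A \<in> sets N"
    then have "A \<in> sets M" using N by (auto simp: subalgebra_def)
    then have "(\<integral>\<omega>\<in>A. inner (e \<omega>) b \<partial>M) = inner (LINT \<omega>:A|M. e \<omega>) b"
      unfolding set_lebesgue_integral_def
      using integral_inner_left[where f = "\<lambda>\<omega>. indicator A \<omega> *\<^sub>R e \<omega>" and c = b]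
        integrable_mult_indicator[OF \<open>A \<in> sets M\<close> e] by simp
    then show "(\<integral>\<omega>\<in>A. inner (e \<omega>) b \<partial>M) = 0" using mean_zero[OF \<open>A \<in> sets N\<close>] by simp
  qed (use e h product_integrable that in auto)
  moreover have "inner (h \<omega>) (e \<omega>) = (\<Sum>b\<in>Basis. inner (h \<omega>) b * inner (e \<omega>) b)" for \<omega>
    by (rule euclidean_inner)
  ultimately show "integrable M (\<lambda>\<omega>. inner (h \<omega>) (e \<omega>))" "(\<integral>\<omega>. inner (h \<omega>) (e \<omega>) \<partial>M) = 0"
    using product_integrable by simp_all
qed

lemma is_filtration_measurable_mono:
  assumes "is_filtration M Fl" "s \<le> t" "f \<in> measurable (Fl s) N"
  shows "f \<in> measurable (Fl t) N"
proof (rule measurable_from_subalg[OF _ assms(3)])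
  show "subalgebra (Fl t) (Fl s)"
    using assms(1,2) by (auto simp: is_filtration_def subalgebra_def)
qed

lemma is_filtration_measurable:
  assumes "is_filtration M Fl" "f \<in> measurable (Fl t) N"
  shows "f \<in> measurable M N"
  using assms by (auto simp: is_filtration_def intro: measurable_from_subalg)

lemma (in prob_space) martingale_sum_second_moment_le:
  fixes e :: "nat \<Rightarrow> 'a \<Rightarrow> 'b::euclidean_space"
  assumes filt: "is_filtration M Fl"
    and adapted: "\<And>t. e t \<in> borel_measurable (Fl (Suc t))" and e: "\<And>t. integrable M (e t)"
    and mean_zero: "\<And>t A. A \<in> sets (Fl t) \<Longrightarrow> (LINT \<omega>:A|M. e t \<omega>) = 0"
    and e2: "\<And>t. integrable M (\<lambda>\<omega>. (norm (e t \<omega>))\<^sup>2)"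
    and second_moment: "\<And>t. (\<integral>\<omega>. (norm (e t \<omega>))\<^sup>2 \<partial>M) \<le> c"
  shows "integrable M (\<lambda>\<omega>. (norm (\<Sum>t\<in>{1..T}. e t \<omega>))\<^sup>2)"
    and "(\<integral>\<omega>. (norm (\<Sum>t\<in>{1..T}. e t \<omega>))\<^sup>2 \<partial>M) \<le> real T * c"
proof -
  have "integrable M (\<lambda>\<omega>. (norm (\<Sum>t\<in>{1..T}. e t \<omega>))\<^sup>2)
      \<and> (\<integral>\<omega>. (norm (\<Sum>t\<in>{1..T}. e t \<omega>))\<^sup>2 \<partial>M) \<le> real T * c"
  proof (induction T)
    case (Suc T)
    define S where "S \<omega> = (\<Sum>t\<in>{1..T}. e t \<omega>)" for \<omega>
    have "subalgebra M (Fl (Suc T))" using filt by (simp add: is_filtration_def)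
    moreover have "S \<in> borel_measurable (Fl (Suc T))"
      unfolding S_def
      by (intro borel_measurable_sum is_filtration_measurable_mono[OF filt _ adapted]) auto
    moreover have "integrable M (\<lambda>\<omega>. (norm (S \<omega>))\<^sup>2)" using Suc.IH by (simp add: S_def)
    ultimately have orth: "integrable M (\<lambda>\<omega>. inner (S \<omega>) (e (Suc T) \<omega>))"
        "(\<integral>\<omega>. inner (S \<omega>) (e (Suc T) \<omega>) \<partial>M) = 0"
      using integral_inner_eq_0_if_cond_mean_zero[OF _ e mean_zero _ _ e2] by blast+
    have expand: "(norm (\<Sum>t\<in>{1..Suc T}. e t \<omega>))\<^sup>2
        = (norm (S \<omega>))\<^sup>2 + 2 * inner (S \<omega>) (e (Suc T) \<omega>) + (norm (e (Suc T) \<omega>))\<^sup>2" for \<omega>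
      using norm_add_scaleR_sq[of "S \<omega>" 1 "e (Suc T) \<omega>"] by (simp add: S_def)
    show ?case
      unfolding expand using Suc.IH orth e2 second_moment[of "Suc T"]
      by (simp add: S_def algebra_simps)
  qed simp
  then show "integrable M (\<lambda>\<omega>. (norm (\<Sum>t\<in>{1..T}. e t \<omega>))\<^sup>2)"
    and "(\<integral>\<omega>. (norm (\<Sum>t\<in>{1..T}. e t \<omega>))\<^sup>2 \<partial>M) \<le> real T * c"
    by simp_all
qed

lemma norm_add_diff_add_sq_le:
  fixes e e' a a' :: "'a::real_normed_vector"
  assumes "norm a \<le> G" "norm a' \<le> G"
  shows "(norm ((e + a) - (e' + a')))\<^sup>2 \<le> 4 * ((norm e)\<^sup>2 + (norm e')\<^sup>2) + 8 * G\<^sup>2"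
proof -
  have "norm ((e + a) - (e' + a')) \<le> norm e + norm e' + 2 * G"
    using norm_triangle_ineq4[of e e'] norm_triangle_ineq4[of a a'] assms
      norm_triangle_ineq[of "e - e'" "a - a'"]
    by (simp add: algebra_simps)
  then have "(norm ((e + a) - (e' + a')))\<^sup>2 \<le> (norm e + norm e' + 2 * G)\<^sup>2"
    by (rule power_mono) simp
  also have "\<dots> \<le> 4 * ((norm e)\<^sup>2 + (norm e')\<^sup>2) + 8 * G\<^sup>2"
    using sum_squares_bound[of "norm e + norm e'" "2 * G"] sum_squares_bound[of "norm e" "norm e'"]
    by (simp add: power2_eq_square algebra_simps)
  finally show ?thesis .
qed

lemma nn_integral_le_integral_bound:
  fixes f b :: "'a \<Rightarrow> real"
  assumes "integrable M b" and "\<And>\<omega>. \<omega> \<in> space M \<Longrightarrow> f \<omega> \<le> b \<omega>"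
    and "\<And>\<omega>. \<omega> \<in> space M \<Longrightarrow> 0 \<le> b \<omega>"
  shows "(\<integral>\<^sup>+\<omega>. ennreal (f \<omega>) \<partial>M) \<le> ennreal (\<integral>\<omega>. b \<omega> \<partial>M)"
proof -
  have "(\<integral>\<^sup>+\<omega>. ennreal (f \<omega>) \<partial>M) \<le> (\<integral>\<^sup>+\<omega>. ennreal (b \<omega>) \<partial>M)"
    using assms(2) by (intro nn_integral_mono ennreal_leI)
  also have "\<dots> = ennreal (\<integral>\<omega>. b \<omega> \<partial>M)"
    using assms(1,3) by (intro nn_integral_eq_integral) (auto intro: AE_I2)
  finally show ?thesis .
qed

lemma adapeg_rate_le:
  fixes T :: nat
  assumes "0 < \<eta>" "0 \<le> R" "0 \<le> G" "0 \<le> \<sigma>"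
    and V: "V \<le> sqrt (8 * real T) * (G + \<sigma>)" and N: "N \<le> sqrt (real T) * \<sigma>"
  shows "\<gamma>0 / 2 * R\<^sup>2 + (R\<^sup>2 / (2 * \<eta>) + \<eta>) * V + R * N
           \<le> 1/2 * \<gamma>0 * R\<^sup>2 + (sqrt 2 * R\<^sup>2 / \<eta> + 4 * sqrt 2 * \<eta> + R) * (G + \<sigma>) * sqrt (real T + 1)"
proof -
  have "sqrt (8 * real T) = 2 * sqrt 2 * sqrt (real T)"
    using real_sqrt_mult[of 4 "2 * real T"] by (simp add: real_sqrt_mult)
  then have "(R\<^sup>2 / (2 * \<eta>) + \<eta>) * V \<le> (sqrt 2 * R\<^sup>2 / \<eta> + 2 * sqrt 2 * \<eta>) * (G + \<sigma>) * sqrt (real T)"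
    using V assms(1) mult_left_mono[OF V, of "R\<^sup>2 / (2 * \<eta>) + \<eta>"] by (simp add: field_simps)
  also have "\<dots> \<le> (sqrt 2 * R\<^sup>2 / \<eta> + 4 * sqrt 2 * \<eta>) * (G + \<sigma>) * sqrt (real T + 1)"
    using assms by (intro mult_mono add_mono) auto
  finally have "(R\<^sup>2 / (2 * \<eta>) + \<eta>) * V \<le> (sqrt 2 * R\<^sup>2 / \<eta> + 4 * sqrt 2 * \<eta>) * (G + \<sigma>) * sqrt (real T + 1)" .
  moreover have "R * N \<le> R * (G + \<sigma>) * sqrt (real T + 1)"
  proof -
    have "sqrt (real T) * \<sigma> \<le> sqrt (real T + 1) * (G + \<sigma>)"
      using assms by (intro mult_mono) auto
    then have "N \<le> (G + \<sigma>) * sqrt (real T + 1)"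
      using N by (simp add: mult.commute)
    then show ?thesis using \<open>0 \<le> R\<close> by (simp add: mult_left_mono mult.assoc)
  qed
  ultimately show ?thesis by (simp add: algebra_simps)
qed

locale stochastic_oracle = prob_space M
  for M :: "'w measure" and Fl :: "nat \<Rightarrow> 'w measure"
    and F :: "'a::euclidean_space \<Rightarrow> 'a" and x g :: "nat \<Rightarrow> 'w \<Rightarrow> 'a" and \<sigma> G :: real +
  assumes filtration: "is_filtration M Fl"
    and g_measurable: "\<And>t. g t \<in> borel_measurable (Fl (Suc t))"
    and x_measurable: "\<And>t. x t \<in> borel_measurable (Fl t)"
    and F_x_measurable: "\<And>t. (\<lambda>\<omega>. F (x t \<omega>)) \<in> borel_measurable (Fl t)"
    and g_integrable: "\<And>t. integrable M (g t)"
    and unbiased: "\<And>t A. A \<in> sets (Fl t) \<Longrightarrow> (LINT \<omega>:A|M. g t \<omega>) = (LINT \<omega>:A|M. F (x t \<omega>))"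
    and bounded_variance:
      "\<And>t. (\<integral>\<^sup>+\<omega>. ennreal ((norm (g t \<omega> - F (x t \<omega>)))\<^sup>2) \<partial>M) \<le> ennreal (\<sigma>\<^sup>2)"
    and norm_F_x_le: "\<And>t \<omega>. \<omega> \<in> space M \<Longrightarrow> norm (F (x t \<omega>)) \<le> G"
    and \<sigma>_nonneg: "0 \<le> \<sigma>"
begin

definition noise :: "nat \<Rightarrow> 'w \<Rightarrow> 'a" where
  "noise t \<omega> = g t \<omega> - F (x t \<omega>)"

lemma G_nonneg: "0 \<le> G"
  using not_empty norm_F_x_le[of _ 0] by (meson ex_in_conv norm_ge_zero order_trans)

lemma noise_adapted: "noise t \<in> borel_measurable (Fl (Suc t))"
proof -
  have "(\<lambda>\<omega>. F (x t \<omega>)) \<in> borel_measurable (Fl (Suc t))"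
    by (rule is_filtration_measurable_mono[OF filtration _ F_x_measurable]) simp
  then show ?thesis
    unfolding noise_def using g_measurable by (intro borel_measurable_diff)
qed

lemma noise_borel_measurable [measurable]: "noise t \<in> borel_measurable M"
  by (rule is_filtration_measurable[OF filtration noise_adapted])

lemma F_x_integrable: "integrable M (\<lambda>\<omega>. F (x t \<omega>))"
proof (rule Bochner_Integration.integrable_bound[of _ "\<lambda>_. G"])
  show "(\<lambda>\<omega>. F (x t \<omega>)) \<in> borel_measurable M"
    by (rule is_filtration_measurable[OF filtration F_x_measurable])
qed (auto intro!: AE_I2 norm_F_x_le simp: abs_of_nonneg[OF G_nonneg])

lemma noise_integrable: "integrable M (noise t)"
  unfolding noise_def using g_integrable F_x_integrable by simp

lemma set_integral_noise:
  assumes "A \<in> sets (Fl t)"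
  shows "(LINT \<omega>:A|M. noise t \<omega>) = 0"
proof -
  have "A \<in> sets M" using assms filtration by (auto simp: is_filtration_def subalgebra_def)
  then have "(LINT \<omega>:A|M. noise t \<omega>) = (LINT \<omega>:A|M. g t \<omega>) - (LINT \<omega>:A|M. F (x t \<omega>))"
    unfolding noise_def using g_integrable F_x_integrable
    by (intro set_integral_diff) (auto simp: set_integrable_def intro!: integrable_mult_indicator)
  then show ?thesis using unbiased[OF assms] by simp
qed

lemma noise_sq_integrable: "integrable M (\<lambda>\<omega>. (norm (noise t \<omega>))\<^sup>2)"
  and integral_noise_sq_le: "(\<integral>\<omega>. (norm (noise t \<omega>))\<^sup>2 \<partial>M) \<le> \<sigma>\<^sup>2"
proof -
  have nn: "(\<integral>\<^sup>+\<omega>. ennreal ((norm (noise t \<omega>))\<^sup>2) \<partial>M) \<le> ennreal (\<sigma>\<^sup>2)"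
    using bounded_variance by (simp add: noise_def)
  then show int: "integrable M (\<lambda>\<omega>. (norm (noise t \<omega>))\<^sup>2)"
    by (intro integrableI_nonneg) (auto simp: top.not_eq_extremum intro: le_less_trans)
  show "(\<integral>\<omega>. (norm (noise t \<omega>))\<^sup>2 \<partial>M) \<le> \<sigma>\<^sup>2"
    using nn nn_integral_eq_integral[OF int] by simp
qed

lemma integral_inner_noise:
  assumes "h \<in> borel_measurable (Fl t)" and "\<And>\<omega>. \<omega> \<in> space M \<Longrightarrow> norm (h \<omega>) \<le> C"
  shows "integrable M (\<lambda>\<omega>. inner (h \<omega>) (noise t \<omega>))"
    and "(\<integral>\<omega>. inner (h \<omega>) (noise t \<omega>) \<partial>M) = 0"
proof -
  have "integrable M (\<lambda>\<omega>. (norm (h \<omega>))\<^sup>2)"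
  proof (rule Bochner_Integration.integrable_bound[of _ "\<lambda>_. C\<^sup>2"])
    show "(\<lambda>\<omega>. (norm (h \<omega>))\<^sup>2) \<in> borel_measurable M"
      using is_filtration_measurable[OF filtration assms(1)] by measurable
  qed (auto intro!: AE_I2 power_mono assms(2))
  then show "integrable M (\<lambda>\<omega>. inner (h \<omega>) (noise t \<omega>))"
    and "(\<integral>\<omega>. inner (h \<omega>) (noise t \<omega>) \<partial>M) = 0"
    using integral_inner_eq_0_if_cond_mean_zero[OF _ noise_integrable set_integral_noise assms(1) _
        noise_sq_integrable] filtration
    by (auto simp: is_filtration_def)
qed

lemma integral_norm_sum_noise_le:
  shows "integrable M (\<lambda>\<omega>. norm (\<Sum>t\<in>{1..T}. noise t \<omega>))"
    and "(\<integral>\<omega>. norm (\<Sum>t\<in>{1..T}. noise t \<omega>) \<partial>M) \<le> sqrt (real T) * \<sigma>"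
proof -
  note second_moment = martingale_sum_second_moment_le[OF filtration noise_adapted noise_integrable
      set_integral_noise noise_sq_integrable integral_noise_sq_le, of T]
  show "integrable M (\<lambda>\<omega>. norm (\<Sum>t\<in>{1..T}. noise t \<omega>))"
    using integral_sqrt_le_sqrt_integral(1)[OF second_moment(1)] by simp
  have "(\<integral>\<omega>. norm (\<Sum>t\<in>{1..T}. noise t \<omega>) \<partial>M) \<le> sqrt (\<integral>\<omega>. (norm (\<Sum>t\<in>{1..T}. noise t \<omega>))\<^sup>2 \<partial>M)"
    using integral_sqrt_le_sqrt_integral(2)[OF second_moment(1)] by simp
  also have "\<dots> \<le> sqrt (real T * \<sigma>\<^sup>2)"
    using second_moment(2) by simp
  also have "\<dots> = sqrt (real T) * \<sigma>"
    using \<sigma>_nonneg by (simp add: real_sqrt_mult)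
  finally show "(\<integral>\<omega>. norm (\<Sum>t\<in>{1..T}. noise t \<omega>) \<partial>M) \<le> sqrt (real T) * \<sigma>" .
qed

lemma sq_variation_le_noise:
  assumes "\<omega> \<in> space M"
  shows "sq_variation (\<lambda>s. g s \<omega>) T
           \<le> (\<Sum>s\<in>{1..T}. 4 * ((norm (noise s \<omega>))\<^sup>2 + (norm (noise (s - 1) \<omega>))\<^sup>2) + 8 * G\<^sup>2)"
  unfolding sq_variation_def
proof (rule sum_mono)
  fix s
  have "g s \<omega> - g (s - 1) \<omega> = (noise s \<omega> + F (x s \<omega>)) - (noise (s - 1) \<omega> + F (x (s - 1) \<omega>))"
    by (simp add: noise_def)
  then show "(norm (g s \<omega> - g (s - 1) \<omega>))\<^sup>2
      \<le> 4 * ((norm (noise s \<omega>))\<^sup>2 + (norm (noise (s - 1) \<omega>))\<^sup>2) + 8 * G\<^sup>2"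
    using norm_add_diff_add_sq_le[OF norm_F_x_le[OF assms] norm_F_x_le[OF assms]] by simp
qed

lemma integral_sqrt_sq_variation_le:
  shows "integrable M (\<lambda>\<omega>. sqrt (sq_variation (\<lambda>s. g s \<omega>) T))"
    and "(\<integral>\<omega>. sqrt (sq_variation (\<lambda>s. g s \<omega>) T) \<partial>M) \<le> sqrt (8 * real T) * (G + \<sigma>)"
proof -
  define b where "b \<omega> = (\<Sum>s\<in>{1..T}. 4 * ((norm (noise s \<omega>))\<^sup>2 + (norm (noise (s - 1) \<omega>))\<^sup>2) + 8 * G\<^sup>2)"
    for \<omega>
  have b_int: "integrable M b"
    unfolding b_def using noise_sq_integrable by simp
  have b_nonneg: "0 \<le> b \<omega>" for \<omega>
    unfolding b_def by (intro sum_nonneg) simp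
  have "(\<integral>\<omega>. b \<omega> \<partial>M) = (\<Sum>s\<in>{1..T}. 4 * ((\<integral>\<omega>. (norm (noise s \<omega>))\<^sup>2 \<partial>M)
      + (\<integral>\<omega>. (norm (noise (s - 1) \<omega>))\<^sup>2 \<partial>M)) + 8 * G\<^sup>2)"
    unfolding b_def using noise_sq_integrable by (simp add: prob_space)
  also have "\<dots> \<le> (\<Sum>s\<in>{1..T}. 8 * (G + \<sigma>)\<^sup>2)"
  proof (rule sum_mono)
    fix s
    have "8 * \<sigma>\<^sup>2 + 8 * G\<^sup>2 \<le> 8 * (G + \<sigma>)\<^sup>2"
      using G_nonneg \<sigma>_nonneg by (simp add: power2_eq_square algebra_simps)
    then show "4 * ((\<integral>\<omega>. (norm (noise s \<omega>))\<^sup>2 \<partial>M) + (\<integral>\<omega>. (norm (noise (s - 1) \<omega>))\<^sup>2 \<partial>M)) + 8 * G\<^sup>2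
        \<le> 8 * (G + \<sigma>)\<^sup>2"
      using integral_noise_sq_le[of s] integral_noise_sq_le[of "s - 1"] by (simp add: algebra_simps)
  qed
  finally have b_le: "(\<integral>\<omega>. b \<omega> \<partial>M) \<le> 8 * real T * (G + \<sigma>)\<^sup>2" by simp
  have variation_le: "sq_variation (\<lambda>s. g s \<omega>) T \<le> b \<omega>" if "\<omega> \<in> space M" for \<omega>
    using sq_variation_le_noise[OF that] by (simp add: b_def)
  note sqrt_b = integral_sqrt_le_sqrt_integral[OF b_int b_nonneg]
  show "integrable M (\<lambda>\<omega>. sqrt (sq_variation (\<lambda>s. g s \<omega>) T))"
  proof (rule Bochner_Integration.integrable_bound[OF sqrt_b(1)])
    show "(\<lambda>\<omega>. sqrt (sq_variation (\<lambda>s. g s \<omega>) T)) \<in> borel_measurable M"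
      using is_filtration_measurable[OF filtration g_measurable] unfolding sq_variation_def by measurable
    show "AE \<omega> in M. norm (sqrt (sq_variation (\<lambda>s. g s \<omega>) T)) \<le> norm (sqrt (b \<omega>))"
      using variation_le by (auto intro!: AE_I2 simp: sq_variation_nonneg b_nonneg)
  qed
  then have "(\<integral>\<omega>. sqrt (sq_variation (\<lambda>s. g s \<omega>) T) \<partial>M) \<le> (\<integral>\<omega>. sqrt (b \<omega>) \<partial>M)"
    using sqrt_b(1) variation_le by (intro integral_mono) auto
  also have "\<dots> \<le> sqrt (8 * real T * (G + \<sigma>)\<^sup>2)"
    using sqrt_b(2) b_le by (meson order_trans real_sqrt_le_mono)
  also have "\<dots> = sqrt (8 * real T) * (G + \<sigma>)"
    using G_nonneg \<sigma>_nonneg by (simp add: real_sqrt_mult)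
  finally show "(\<integral>\<omega>. sqrt (sq_variation (\<lambda>s. g s \<omega>) T) \<partial>M) \<le> sqrt (8 * real T) * (G + \<sigma>)" .
qed

lemma integral_adapeg_bound_le:
  fixes \<gamma>0 :: real and T :: nat
  assumes "0 < \<eta>" "0 \<le> R" and near: "\<And>t \<omega>. \<omega> \<in> space M \<Longrightarrow> norm (x t \<omega> - p) \<le> R"
  defines "B \<equiv> \<lambda>\<omega>. adapeg_gap_bound \<eta> \<gamma>0 R (\<lambda>s. g s \<omega>) (\<lambda>t. noise t \<omega>) (\<lambda>t. x t \<omega>) p T"
  shows "integrable M B"
    and "(\<integral>\<omega>. B \<omega> \<partial>M)
           \<le> 1/2 * \<gamma>0 * R\<^sup>2 + (sqrt 2 * R\<^sup>2 / \<eta> + 4 * sqrt 2 * \<eta> + R) * (G + \<sigma>) * sqrt (real T + 1)"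
proof -
  have "(\<lambda>\<omega>. x t \<omega> - p) \<in> borel_measurable (Fl t)" for t
    using x_measurable by (intro borel_measurable_diff) auto
  then have "integrable M (\<lambda>\<omega>. inner (x t \<omega> - p) (noise t \<omega>))"
      "(\<integral>\<omega>. inner (x t \<omega> - p) (noise t \<omega>) \<partial>M) = 0" for t
    using integral_inner_noise near by blast+
  then show "integrable M B"
    and "(\<integral>\<omega>. B \<omega> \<partial>M)
           \<le> 1/2 * \<gamma>0 * R\<^sup>2 + (sqrt 2 * R\<^sup>2 / \<eta> + 4 * sqrt 2 * \<eta> + R) * (G + \<sigma>) * sqrt (real T + 1)"
    unfolding B_def adapeg_gap_bound_def
    using integral_sqrt_sq_variation_le integral_norm_sum_noise_le
      adapeg_rate_le[OF assms(1,2) G_nonneg \<sigma>_nonneg integral_sqrt_sq_variation_le(2)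
        integral_norm_sum_noise_le(2)]
    by (simp_all add: prob_space)
qed

end

theorem lemmaB12:
  fixes X :: "(real^'n) set" and F :: "real^'n \<Rightarrow> real^'n"
    and M :: "'w measure" and Fl :: "nat \<Rightarrow> 'w measure"
    and g x z :: "nat \<Rightarrow> 'w \<Rightarrow> real^'n"
    and x0 :: "real^'n"
    and R \<sigma> \<gamma>0 \<eta> :: real and T :: nat
  assumes prob: "prob_space M"
    and X_ne: "X \<noteq> {}" and X_closed: "closed X" and X_convex: "convex X" and X_bdd: "bounded X"
    and R_diam: "\<forall>u\<in>X. \<forall>v\<in>X. norm (u - v) \<le> R"
    and F_mono: "\<forall>u\<in>X. \<forall>v\<in>X. inner (F u - F v) (u - v) \<ge> 0"
    and F_bdd: "bdd_above ((\<lambda>u. norm (F u)) ` X)"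
    and \<gamma>0_nonneg: "\<gamma>0 \<ge> 0" and \<eta>_pos: "\<eta> > 0" and \<sigma>_nonneg: "\<sigma> \<ge> 0"
    and T_pos: "T \<ge> 1"
    \<comment> \<open>natural filtration of the process: F_t contains the history up to the query of x_t\<close>
    and filt: "is_filtration M Fl"
    and g_meas: "\<forall>t. g t \<in> borel_measurable (Fl (Suc t))"
    and x_meas: "\<forall>t. x t \<in> borel_measurable (Fl t)"
    and z_meas: "\<forall>t. z t \<in> borel_measurable (Fl (Suc t))"
    \<comment> \<open>stochastic oracle: E[g_t | F_t] = F(x_t) and E||g_t - F(x_t)||^2 \<le> sigma^2\<close>
    and g_int: "\<forall>t. integrable M (g t)"
    and Fx_meas: "\<forall>t. (\<lambda>\<omega>. F (x t \<omega>)) \<in> borel_measurable (Fl t)"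
    and unbiased: "\<forall>t. \<forall>A\<in>sets (Fl t).
        (LINT \<omega>:A|M. g t \<omega>) = (LINT \<omega>:A|M. F (x t \<omega>))"
    and variance: "\<forall>t. (\<integral>\<^sup>+\<omega>. ennreal ((norm (g t \<omega> - F (x t \<omega>)))\<^sup>2) \<partial>M) \<le> ennreal (\<sigma>\<^sup>2)"
    \<comment> \<open>algorithm AdaPEG\<close>
    and x0_in: "x0 \<in> X"
    and init: "\<forall>\<omega>\<in>space M. x 0 \<omega> = x0 \<and> z 0 \<omega> = x0"
    and x_step: "\<forall>t\<ge>1. \<forall>\<omega>\<in>space M.
        is_arg_min (\<lambda>u. inner (g (t - 1) \<omega>) u
                       + 1/2 * adapeg_gamma \<eta> \<gamma>0 (\<lambda>s. g s \<omega>) (t - 1) * (norm (u - z (t - 1) \<omega>))\<^sup>2)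
                   (\<lambda>u. u \<in> X) (x t \<omega>)"
    and z_step: "\<forall>t\<ge>1. \<forall>\<omega>\<in>space M.
        is_arg_min (\<lambda>u. inner (g t \<omega>) u
                       + 1/2 * adapeg_gamma \<eta> \<gamma>0 (\<lambda>s. g s \<omega>) (t - 1) * (norm (u - z (t - 1) \<omega>))\<^sup>2
                       + 1/2 * (adapeg_gamma \<eta> \<gamma>0 (\<lambda>s. g s \<omega>) t
                                - adapeg_gamma \<eta> \<gamma>0 (\<lambda>s. g s \<omega>) (t - 1)) * (norm (u - x t \<omega>))\<^sup>2)
                   (\<lambda>u. u \<in> X) (z t \<omega>)"
  shows "(\<integral>\<^sup>+\<omega>. ennreal (Err X F ((1 / real T) *\<^sub>R (\<Sum>t\<in>{1..T}. x t \<omega>))) \<partial>M)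
         \<le> ennreal ((1 / real T) *
              (1/2 * \<gamma>0 * R\<^sup>2
               + (sqrt 2 * R\<^sup>2 / \<eta> + 4 * sqrt 2 * \<eta> + R)
                 * ((SUP u\<in>X. norm (F u)) + \<sigma>) * sqrt (real T + 1)))"
proof -
  \<comment> \<open>\<open>X_ne\<close> follows from \<open>x0_in\<close>; \<open>X_closed\<close>, \<open>X_bdd\<close> and \<open>z_meas\<close> only serve the existence
     and measurability of the iterates, which the hypotheses already provide.\<close>
  interpret prob_space M by (rule prob)
  have iter: "adapeg_iterates X \<eta> \<gamma>0 (\<lambda>s. g s \<omega>) (\<lambda>t. x t \<omega>) (\<lambda>t. z t \<omega>)" if "\<omega> \<in> space M" for \<omega>
    unfolding adapeg_iterates_def
    apply (intro allI conjI)
    subgoal for t using x_step[rule_format, of "Suc t" \<omega>] that by simp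
    subgoal for t using z_step[rule_format, of "Suc t" \<omega>] that by simp
    done
  have x_in: "x t \<omega> \<in> X" if "\<omega> \<in> space M" for t \<omega>
    using adapeg_iterates_in(1)[OF iter[OF that]] init x0_in that by (cases t) auto
  interpret stochastic_oracle M Fl F x g \<sigma> "SUP u\<in>X. norm (F u)"
    using filt g_meas x_meas Fx_meas g_int unbiased variance \<sigma>_nonneg x_in
    by unfold_locales (auto intro!: cSUP_upper2[OF F_bdd])
  have "0 \<le> R" using R_diam x0_in by force
  note bound = integral_adapeg_bound_le[OF \<eta>_pos \<open>0 \<le> R\<close>, of x0 \<gamma>0 T]
  have gap: "Err X F ((1 / real T) *\<^sub>R (\<Sum>t\<in>{1..T}. x t \<omega>))
        \<le> adapeg_gap_bound \<eta> \<gamma>0 R (\<lambda>s. g s \<omega>) (\<lambda>t. noise t \<omega>) (\<lambda>t. x t \<omega>) x0 T / real T"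
      "0 \<le> Err X F ((1 / real T) *\<^sub>R (\<Sum>t\<in>{1..T}. x t \<omega>))" if "\<omega> \<in> space M" for \<omega>
    using adapeg_Err_average_le[OF X_convex _ x0_in R_diam F_mono \<eta>_pos \<gamma>0_nonneg T_pos iter[OF that]]
      init that x0_in by (simp_all add: noise_def)
  have "(\<integral>\<^sup>+\<omega>. ennreal (Err X F ((1 / real T) *\<^sub>R (\<Sum>t\<in>{1..T}. x t \<omega>))) \<partial>M)
      \<le> ennreal (\<integral>\<omega>. adapeg_gap_bound \<eta> \<gamma>0 R (\<lambda>s. g s \<omega>) (\<lambda>t. noise t \<omega>) (\<lambda>t. x t \<omega>) x0 T / real T \<partial>M)"
    using bound(1) gap R_diam x_in x0_in by (intro nn_integral_le_integral_bound) (auto intro: order_trans)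
  also have "\<dots> \<le> ennreal ((1 / real T) * (1/2 * \<gamma>0 * R\<^sup>2
      + (sqrt 2 * R\<^sup>2 / \<eta> + 4 * sqrt 2 * \<eta> + R) * ((SUP u\<in>X. norm (F u)) + \<sigma>) * sqrt (real T + 1)))"
    using bound(2) R_diam x_in x0_in by (intro ennreal_leI) (simp add: divide_right_mono)
  finally show ?thesis .
qed

end
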